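(* Let $(T,\mu,\eta,c,u)$ be a colax gs-monoidal monad on a preorder-enriched gs-monoidal category $\mathcal{C}$. If $\mathcal{C}$ is oplax cartesian, then so is the Kleisli category $\mathcal{C}_T$.
   Context: Coherence isomorphisms of monoidal structures are suppressed; $\gamma$ denotes the braiding. A gs-monoidal category is a symmetric monoidal category $(\mathcal{C},\otimes,I)$ together with, for every object $X$, arrows $\nabla_X\colon X\to X\otimes X$ and $!_X\colon X\to I$ making $X$ a commutative comonoid, with $\nabla_{X\otimes Y}=(\mathrm{id}_X\otimes\gamma_{X,Y}\otimes\mathrm{id}_Y)\circ(\nabla_X\otimes\nabla_Y)$, $\nabla_I=\mathrm{id}_I$, $!_{X\otimes Y}=\,!_X\otimes !_Y$, $!_I=\mathrm{id}_I$ (no naturality required). A preorder-enriched gs-monoidal category is a gs-monoidal category whose hom-sets are preordered so that composition and $\otimes$ are monotone. It is oplax cartesian if for every arrow $f\colon X\to Y$ one has $\nabla_Y\circ f\le(f\otimes f)\circ\nabla_X$ and $!_Y\circ f\le\,!_X$. A symmetric monoidal monad $(T,\mu,\eta,c,u)$ on a symmetric monoidal category is a monad $(T,\mu,\eta)$ together with a lax symmetric monoidal structure on $T$ given by $c_{X,Y}\colon TX\otimes TY\to T(X\otimes Y)$ (natural) and $u\colon I\to TI$, such that $u=\eta_I$, $c_{X,Y}\circ(\eta_X\otimes\eta_Y)=\eta_{X\otimes Y}$, and $\mu_{X\otimes Y}\circ T(c_{X,Y})\circ c_{TX,TY}=c_{X,Y}\circ(\mu_X\otimes\mu_Y)$.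 On a preorder-enriched gs-monoidal category it is a colax gs-monoidal monad if $T$ is a preorder-enriched functor (monotone on hom-preorders) and for all $X$: $T(!_X)\le u\circ !_{TX}$ (colax affine) and $T(\nabla_X)\le c_{X,X}\circ\nabla_{TX}$ (colax relevant). The Kleisli category $\mathcal{C}_T$ is regarded as a preorder-enriched gs-monoidal category with: hom-preorders $\mathcal{C}_T(X,Y)=\mathcal{C}(X,TY)$; $X\otimes^\sharp Y:=X\otimes Y$ on objects; $f\otimes^\sharp g:=c_{X',Y'}\circ(f\otimes g)$ for $f\colon X\to TX'$, $g\colon Y\to TY'$; unit $I$; structural isomorphisms those of $\mathcal{C}$ postcomposed with $\eta$; $\nabla^\sharp_X:=\eta_{X\otimes X}\circ\nabla_X$ and $!^\sharp_X:=\eta_I\circ !_X$. *)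

theory Defs
  imports Main
begin

text \<open>
  Arrows carry their domain and codomain; objects and arrows are carrier sets.
  The paper suppresses the coherence isomorphisms; here monoidal categories are not assumed strict
  and the associator \<open>\<alpha>\<close>, the unitors \<open>\<lambda>\<close>, \<open>\<rho>\<close> and the braiding \<open>\<gamma>\<close> are explicit data
  (fields \<open>Assoc\<close>, \<open>Lunit\<close>, \<open>Runit\<close>, \<open>Braid\<close>), inserted wherever the paper omits them.
\<close>

record ('o, 'a) category_data =
  Obj :: "'o set"
  Arr :: "'a set"
  Dom :: "'a \<Rightarrow> 'o"
  Cod :: "'a \<Rightarrow> 'o"
  Ident :: "'o \<Rightarrow> 'a"
  Comp :: "'a \<Rightarrow> 'a \<Rightarrow> 'a"  (infixr "\<cdot>\<index>" 55)

record ('o, 'a) monoidal_data = "('o, 'a) category_data" +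
  TensO :: "'o \<Rightarrow> 'o \<Rightarrow> 'o"  (infixr "\<otimes>\<^sub>o\<index>" 60)
  TensA :: "'a \<Rightarrow> 'a \<Rightarrow> 'a"  (infixr "\<otimes>\<index>" 60)
  Unit :: 'o  ("\<I>\<index>")
  Assoc :: "'o \<Rightarrow> 'o \<Rightarrow> 'o \<Rightarrow> 'a"
  Lunit :: "'o \<Rightarrow> 'a"
  Runit :: "'o \<Rightarrow> 'a"
  Braid :: "'o \<Rightarrow> 'o \<Rightarrow> 'a"

record ('o, 'a) gs_data = "('o, 'a) monoidal_data" +
  Dup :: "'o \<Rightarrow> 'a"  ("\<nabla>\<index>")
  Del :: "'o \<Rightarrow> 'a"  ("!\<index>")

record ('o, 'a) pgs_data = "('o, 'a) gs_data" +
  Leq :: "'a \<Rightarrow> 'a \<Rightarrow> bool"  (infix "\<preceq>\<index>" 50)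

definition hom :: "('o, 'a, 'm) category_data_scheme \<Rightarrow> 'o \<Rightarrow> 'o \<Rightarrow> 'a set" where
  "hom C X Y = {f \<in> Arr C. Dom C f = X \<and> Cod C f = Y}"

definition inverse_arrows :: "('o, 'a, 'm) category_data_scheme \<Rightarrow> 'a \<Rightarrow> 'a \<Rightarrow> bool" where
  "inverse_arrows C f g \<longleftrightarrow>
     f \<in> Arr C \<and> g \<in> hom C (Cod C f) (Dom C f) \<and>
     Comp C g f = Ident C (Dom C f) \<and> Comp C f g = Ident C (Cod C f)"

definition iso :: "('o, 'a, 'm) category_data_scheme \<Rightarrow> 'a \<Rightarrow> bool" where
  "iso C f \<longleftrightarrow> (\<exists>g. inverse_arrows C f g)"

definition inv_arrow :: "('o, 'a, 'm) category_data_scheme \<Rightarrow> 'a \<Rightarrow> 'a" where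
  "inv_arrow C f = (THE g. inverse_arrows C f g)"

locale category =
  fixes C :: "('o, 'a, 'm) category_data_scheme" (structure)
  assumes dom_closed: "f \<in> Arr C \<Longrightarrow> Dom C f \<in> Obj C"
    and cod_closed: "f \<in> Arr C \<Longrightarrow> Cod C f \<in> Obj C"
    and id_in_hom: "X \<in> Obj C \<Longrightarrow> Ident C X \<in> hom C X X"
    and comp_in_hom: "\<lbrakk>f \<in> hom C X Y; g \<in> hom C Y Z\<rbrakk> \<Longrightarrow> g \<cdot> f \<in> hom C X Z"
    and comp_id_left: "f \<in> hom C X Y \<Longrightarrow> Ident C Y \<cdot> f = f"
    and comp_id_right: "f \<in> hom C X Y \<Longrightarrow> f \<cdot> Ident C X = f"
    and comp_assoc: "\<lbrakk>f \<in> hom C X Y; g \<in> hom C Y Z; h \<in> hom C Z W\<rbrakk> \<Longrightarrow>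
          (h \<cdot> g) \<cdot> f = h \<cdot> (g \<cdot> f)"

locale symmetric_monoidal_category = category C
  for C :: "('o, 'a, 'm) monoidal_data_scheme" (structure) +
  assumes unit_obj: "\<I> \<in> Obj C"
    and tensor_obj: "\<lbrakk>X \<in> Obj C; Y \<in> Obj C\<rbrakk> \<Longrightarrow> X \<otimes>\<^sub>o Y \<in> Obj C"
    and tensor_in_hom: "\<lbrakk>f \<in> hom C X X'; g \<in> hom C Y Y'\<rbrakk> \<Longrightarrow>
          f \<otimes> g \<in> hom C (X \<otimes>\<^sub>o Y) (X' \<otimes>\<^sub>o Y')"
    and tensor_id: "\<lbrakk>X \<in> Obj C; Y \<in> Obj C\<rbrakk> \<Longrightarrow> Ident C X \<otimes> Ident C Y = Ident C (X \<otimes>\<^sub>o Y)"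
    and tensor_comp:
      "\<lbrakk>f \<in> hom C X X'; f' \<in> hom C X' X''; g \<in> hom C Y Y'; g' \<in> hom C Y' Y''\<rbrakk> \<Longrightarrow>
          (f' \<cdot> f) \<otimes> (g' \<cdot> g) = (f' \<otimes> g') \<cdot> (f \<otimes> g)"
    and assoc_in_hom: "\<lbrakk>X \<in> Obj C; Y \<in> Obj C; Z \<in> Obj C\<rbrakk> \<Longrightarrow>
          Assoc C X Y Z \<in> hom C ((X \<otimes>\<^sub>o Y) \<otimes>\<^sub>o Z) (X \<otimes>\<^sub>o (Y \<otimes>\<^sub>o Z))"
    and assoc_iso: "\<lbrakk>X \<in> Obj C; Y \<in> Obj C; Z \<in> Obj C\<rbrakk> \<Longrightarrow> iso C (Assoc C X Y Z)"
    and assoc_natural: "\<lbrakk>f \<in> hom C X X'; g \<in> hom C Y Y'; h \<in> hom C Z Z'\<rbrakk> \<Longrightarrow>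
          Assoc C X' Y' Z' \<cdot> ((f \<otimes> g) \<otimes> h) = (f \<otimes> (g \<otimes> h)) \<cdot> Assoc C X Y Z"
    and lunit_in_hom: "X \<in> Obj C \<Longrightarrow> Lunit C X \<in> hom C (\<I> \<otimes>\<^sub>o X) X"
    and lunit_iso: "X \<in> Obj C \<Longrightarrow> iso C (Lunit C X)"
    and lunit_natural: "f \<in> hom C X Y \<Longrightarrow> Lunit C Y \<cdot> (Ident C \<I> \<otimes> f) = f \<cdot> Lunit C X"
    and runit_in_hom: "X \<in> Obj C \<Longrightarrow> Runit C X \<in> hom C (X \<otimes>\<^sub>o \<I>) X"
    and runit_iso: "X \<in> Obj C \<Longrightarrow> iso C (Runit C X)"
    and runit_natural: "f \<in> hom C X Y \<Longrightarrow> Runit C Y \<cdot> (f \<otimes> Ident C \<I>) = f \<cdot> Runit C X"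
    and braid_in_hom: "\<lbrakk>X \<in> Obj C; Y \<in> Obj C\<rbrakk> \<Longrightarrow>
          Braid C X Y \<in> hom C (X \<otimes>\<^sub>o Y) (Y \<otimes>\<^sub>o X)"
    and braid_natural: "\<lbrakk>f \<in> hom C X X'; g \<in> hom C Y Y'\<rbrakk> \<Longrightarrow>
          Braid C X' Y' \<cdot> (f \<otimes> g) = (g \<otimes> f) \<cdot> Braid C X Y"
    and braid_symmetric: "\<lbrakk>X \<in> Obj C; Y \<in> Obj C\<rbrakk> \<Longrightarrow>
          Braid C Y X \<cdot> Braid C X Y = Ident C (X \<otimes>\<^sub>o Y)"
    and pentagon: "\<lbrakk>W \<in> Obj C; X \<in> Obj C; Y \<in> Obj C; Z \<in> Obj C\<rbrakk> \<Longrightarrow>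
          Assoc C W X (Y \<otimes>\<^sub>o Z) \<cdot> Assoc C (W \<otimes>\<^sub>o X) Y Z =
          (Ident C W \<otimes> Assoc C X Y Z) \<cdot> Assoc C W (X \<otimes>\<^sub>o Y) Z \<cdot> (Assoc C W X Y \<otimes> Ident C Z)"
    and triangle: "\<lbrakk>X \<in> Obj C; Y \<in> Obj C\<rbrakk> \<Longrightarrow>
          (Ident C X \<otimes> Lunit C Y) \<cdot> Assoc C X \<I> Y = Runit C X \<otimes> Ident C Y"
    and hexagon: "\<lbrakk>X \<in> Obj C; Y \<in> Obj C; Z \<in> Obj C\<rbrakk> \<Longrightarrow>
          Assoc C Y Z X \<cdot> Braid C X (Y \<otimes>\<^sub>o Z) \<cdot> Assoc C X Y Z =
          (Ident C Y \<otimes> Braid C X Z) \<cdot> Assoc C Y X Z \<cdot> (Braid C X Y \<otimes> Ident C Z)"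

text \<open>
  The arrow \<open>id\<^sub>X \<otimes> \<gamma>\<^bsub>X,Y\<^esub> \<otimes> id\<^sub>Y\<close> with its coherence isomorphisms written out, from
  \<open>(X \<otimes> X) \<otimes> (Y \<otimes> Y)\<close> to \<open>(X \<otimes> Y) \<otimes> (X \<otimes> Y)\<close>.
\<close>

definition middle_swap :: "('o, 'a, 'm) monoidal_data_scheme \<Rightarrow> 'o \<Rightarrow> 'o \<Rightarrow> 'a" where
  "middle_swap C X Y =
     inv_arrow C (Assoc C X Y (X \<otimes>\<^sub>o\<^bsub>C\<^esub> Y)) \<cdot>\<^bsub>C\<^esub>
     (Ident C X \<otimes>\<^bsub>C\<^esub>
        (Assoc C Y X Y \<cdot>\<^bsub>C\<^esub> (Braid C X Y \<otimes>\<^bsub>C\<^esub> Ident C Y) \<cdot>\<^bsub>C\<^esub> inv_arrow C (Assoc C X Y Y))) \<cdot>\<^bsub>C\<^esub>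
     Assoc C X X (Y \<otimes>\<^sub>o\<^bsub>C\<^esub> Y)"

locale gs_monoidal_category = symmetric_monoidal_category C
  for C :: "('o, 'a, 'm) gs_data_scheme" (structure) +
  assumes dup_in_hom: "X \<in> Obj C \<Longrightarrow> \<nabla> X \<in> hom C X (X \<otimes>\<^sub>o X)"
    and del_in_hom: "X \<in> Obj C \<Longrightarrow> ! X \<in> hom C X \<I>"
    and dup_coassoc: "X \<in> Obj C \<Longrightarrow>
          Assoc C X X X \<cdot> (\<nabla> X \<otimes> Ident C X) \<cdot> \<nabla> X = (Ident C X \<otimes> \<nabla> X) \<cdot> \<nabla> X"
    and dup_counit_left: "X \<in> Obj C \<Longrightarrow> Lunit C X \<cdot> (! X \<otimes> Ident C X) \<cdot> \<nabla> X = Ident C X"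
    and dup_counit_right: "X \<in> Obj C \<Longrightarrow> Runit C X \<cdot> (Ident C X \<otimes> ! X) \<cdot> \<nabla> X = Ident C X"
    and dup_commutative: "X \<in> Obj C \<Longrightarrow> Braid C X X \<cdot> \<nabla> X = \<nabla> X"
    and dup_tensor: "\<lbrakk>X \<in> Obj C; Y \<in> Obj C\<rbrakk> \<Longrightarrow>
          \<nabla> (X \<otimes>\<^sub>o Y) = middle_swap C X Y \<cdot> (\<nabla> X \<otimes> \<nabla> Y)"
    and dup_unit: "\<nabla> \<I> = inv_arrow C (Lunit C \<I>)"
    and del_tensor: "\<lbrakk>X \<in> Obj C; Y \<in> Obj C\<rbrakk> \<Longrightarrow>
          ! (X \<otimes>\<^sub>o Y) = Lunit C \<I> \<cdot> (! X \<otimes> ! Y)"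
    and del_unit: "! \<I> = Ident C \<I>"

text \<open>Only comparisons between parallel arrows are meaningful.\<close>

locale preorder_enriched_gs_monoidal_category = gs_monoidal_category C
  for C :: "('o, 'a, 'm) pgs_data_scheme" (structure) +
  assumes hom_refl: "\<lbrakk>X \<in> Obj C; Y \<in> Obj C\<rbrakk> \<Longrightarrow> reflp_on (hom C X Y) (\<preceq>)"
    and hom_trans: "\<lbrakk>X \<in> Obj C; Y \<in> Obj C\<rbrakk> \<Longrightarrow> transp_on (hom C X Y) (\<preceq>)"
    and comp_mono:
      "\<lbrakk>f \<in> hom C X Y; f' \<in> hom C X Y; g \<in> hom C Y Z; g' \<in> hom C Y Z; f \<preceq> f'; g \<preceq> g'\<rbrakk> \<Longrightarrow>
          g \<cdot> f \<preceq> g' \<cdot> f'"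
    and tensor_mono:
      "\<lbrakk>f \<in> hom C X X'; f' \<in> hom C X X'; g \<in> hom C Y Y'; g' \<in> hom C Y Y'; f \<preceq> f'; g \<preceq> g'\<rbrakk> \<Longrightarrow>
          f \<otimes> g \<preceq> f' \<otimes> g'"

locale oplax_cartesian_category = preorder_enriched_gs_monoidal_category C
  for C :: "('o, 'a, 'm) pgs_data_scheme" (structure) +
  assumes dup_oplax: "f \<in> hom C X Y \<Longrightarrow> \<nabla> Y \<cdot> f \<preceq> (f \<otimes> f) \<cdot> \<nabla> X"
    and del_oplax: "f \<in> hom C X Y \<Longrightarrow> ! Y \<cdot> f \<preceq> ! X"

text \<open>The endofunctor \<open>T\<close> is given by its object part \<open>T\<^sub>o\<close> and its arrow part \<open>T\<^sub>a\<close>.\<close>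

locale symmetric_monoidal_monad = symmetric_monoidal_category C
  for C :: "('o, 'a, 'm) monoidal_data_scheme" (structure)
    and T\<^sub>o :: "'o \<Rightarrow> 'o" and T\<^sub>a :: "'a \<Rightarrow> 'a"
    and \<mu> :: "'o \<Rightarrow> 'a" and \<eta> :: "'o \<Rightarrow> 'a"
    and c :: "'o \<Rightarrow> 'o \<Rightarrow> 'a" and u :: 'a +
  assumes functor_obj: "X \<in> Obj C \<Longrightarrow> T\<^sub>o X \<in> Obj C"
    and functor_in_hom: "f \<in> hom C X Y \<Longrightarrow> T\<^sub>a f \<in> hom C (T\<^sub>o X) (T\<^sub>o Y)"
    and functor_id: "X \<in> Obj C \<Longrightarrow> T\<^sub>a (Ident C X) = Ident C (T\<^sub>o X)"
    and functor_comp: "\<lbrakk>f \<in> hom C X Y; g \<in> hom C Y Z\<rbrakk> \<Longrightarrow> T\<^sub>a (g \<cdot> f) = T\<^sub>a g \<cdot> T\<^sub>a f"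
    and mu_in_hom: "X \<in> Obj C \<Longrightarrow> \<mu> X \<in> hom C (T\<^sub>o (T\<^sub>o X)) (T\<^sub>o X)"
    and mu_natural: "f \<in> hom C X Y \<Longrightarrow> \<mu> Y \<cdot> T\<^sub>a (T\<^sub>a f) = T\<^sub>a f \<cdot> \<mu> X"
    and eta_in_hom: "X \<in> Obj C \<Longrightarrow> \<eta> X \<in> hom C X (T\<^sub>o X)"
    and eta_natural: "f \<in> hom C X Y \<Longrightarrow> \<eta> Y \<cdot> f = T\<^sub>a f \<cdot> \<eta> X"
    and monad_assoc: "X \<in> Obj C \<Longrightarrow> \<mu> X \<cdot> T\<^sub>a (\<mu> X) = \<mu> X \<cdot> \<mu> (T\<^sub>o X)"
    and monad_unit_left: "X \<in> Obj C \<Longrightarrow> \<mu> X \<cdot> \<eta> (T\<^sub>o X) = Ident C (T\<^sub>o X)"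
    and monad_unit_right: "X \<in> Obj C \<Longrightarrow> \<mu> X \<cdot> T\<^sub>a (\<eta> X) = Ident C (T\<^sub>o X)"
    and lax_in_hom: "\<lbrakk>X \<in> Obj C; Y \<in> Obj C\<rbrakk> \<Longrightarrow>
          c X Y \<in> hom C (T\<^sub>o X \<otimes>\<^sub>o T\<^sub>o Y) (T\<^sub>o (X \<otimes>\<^sub>o Y))"
    and lax_natural: "\<lbrakk>f \<in> hom C X X'; g \<in> hom C Y Y'\<rbrakk> \<Longrightarrow>
          c X' Y' \<cdot> (T\<^sub>a f \<otimes> T\<^sub>a g) = T\<^sub>a (f \<otimes> g) \<cdot> c X Y"
    and lax_unit_in_hom: "u \<in> hom C \<I> (T\<^sub>o \<I>)"
    and lax_assoc: "\<lbrakk>X \<in> Obj C; Y \<in> Obj C; Z \<in> Obj C\<rbrakk> \<Longrightarrow>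
          T\<^sub>a (Assoc C X Y Z) \<cdot> c (X \<otimes>\<^sub>o Y) Z \<cdot> (c X Y \<otimes> Ident C (T\<^sub>o Z)) =
          c X (Y \<otimes>\<^sub>o Z) \<cdot> (Ident C (T\<^sub>o X) \<otimes> c Y Z) \<cdot> Assoc C (T\<^sub>o X) (T\<^sub>o Y) (T\<^sub>o Z)"
    and lax_unit_left: "X \<in> Obj C \<Longrightarrow>
          T\<^sub>a (Lunit C X) \<cdot> c \<I> X \<cdot> (u \<otimes> Ident C (T\<^sub>o X)) = Lunit C (T\<^sub>o X)"
    and lax_unit_right: "X \<in> Obj C \<Longrightarrow>
          T\<^sub>a (Runit C X) \<cdot> c X \<I> \<cdot> (Ident C (T\<^sub>o X) \<otimes> u) = Runit C (T\<^sub>o X)"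
    and lax_symmetric: "\<lbrakk>X \<in> Obj C; Y \<in> Obj C\<rbrakk> \<Longrightarrow>
          T\<^sub>a (Braid C X Y) \<cdot> c X Y = c Y X \<cdot> Braid C (T\<^sub>o X) (T\<^sub>o Y)"
    and unit_eq_eta: "u = \<eta> \<I>"
    and eta_monoidal: "\<lbrakk>X \<in> Obj C; Y \<in> Obj C\<rbrakk> \<Longrightarrow> c X Y \<cdot> (\<eta> X \<otimes> \<eta> Y) = \<eta> (X \<otimes>\<^sub>o Y)"
    and mu_monoidal: "\<lbrakk>X \<in> Obj C; Y \<in> Obj C\<rbrakk> \<Longrightarrow>
          \<mu> (X \<otimes>\<^sub>o Y) \<cdot> T\<^sub>a (c X Y) \<cdot> c (T\<^sub>o X) (T\<^sub>o Y) = c X Y \<cdot> (\<mu> X \<otimes> \<mu> Y)"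

locale colax_gs_monoidal_monad =
  preorder_enriched_gs_monoidal_category C + symmetric_monoidal_monad C T\<^sub>o T\<^sub>a \<mu> \<eta> c u
  for C :: "('o, 'a, 'm) pgs_data_scheme" (structure)
    and T\<^sub>o T\<^sub>a \<mu> \<eta> c u +
  assumes functor_mono: "\<lbrakk>f \<in> hom C X Y; g \<in> hom C X Y; f \<preceq> g\<rbrakk> \<Longrightarrow> T\<^sub>a f \<preceq> T\<^sub>a g"
    and colax_affine: "X \<in> Obj C \<Longrightarrow> T\<^sub>a (! X) \<preceq> u \<cdot> ! (T\<^sub>o X)"
    and colax_relevant: "X \<in> Obj C \<Longrightarrow> T\<^sub>a (\<nabla> X) \<preceq> c X X \<cdot> \<nabla> (T\<^sub>o X)"

text \<open>
  The object part of \<open>T\<close> need not be injective, so a Kleisli arrow \<open>f : X \<rightarrow> T Y\<close> is tagged with its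
  Kleisli domain and codomain as \<open>(X, f, Y)\<close>.
\<close>

definition kleisli_embed ::
    "('o, 'a, 'm) category_data_scheme \<Rightarrow> ('o \<Rightarrow> 'a) \<Rightarrow> 'a \<Rightarrow> 'o \<times> 'a \<times> 'o" where
  "kleisli_embed C \<eta> f = (Dom C f, \<eta> (Cod C f) \<cdot>\<^bsub>C\<^esub> f, Cod C f)"

definition Kleisli ::
    "('o, 'a) pgs_data \<Rightarrow> ('o \<Rightarrow> 'o) \<Rightarrow> ('a \<Rightarrow> 'a) \<Rightarrow> ('o \<Rightarrow> 'a) \<Rightarrow> ('o \<Rightarrow> 'a) \<Rightarrow>
     ('o \<Rightarrow> 'o \<Rightarrow> 'a) \<Rightarrow> ('o, 'o \<times> 'a \<times> 'o) pgs_data" where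
  "Kleisli C T\<^sub>o T\<^sub>a \<mu> \<eta> c = \<lparr>
     Obj = Obj C,
     Arr = {(X, f, Y). X \<in> Obj C \<and> Y \<in> Obj C \<and> f \<in> hom C X (T\<^sub>o Y)},
     Dom = (\<lambda>(X, f, Y). X),
     Cod = (\<lambda>(X, f, Y). Y),
     Ident = (\<lambda>X. (X, \<eta> X, X)),
     Comp = (\<lambda>(Y, g, Z) (X, f, Y'). (X, \<mu> Z \<cdot>\<^bsub>C\<^esub> T\<^sub>a g \<cdot>\<^bsub>C\<^esub> f, Z)),
     TensO = TensO C,
     TensA = (\<lambda>(X, f, X') (Y, g, Y').
       (X \<otimes>\<^sub>o\<^bsub>C\<^esub> Y, c X' Y' \<cdot>\<^bsub>C\<^esub> (f \<otimes>\<^bsub>C\<^esub> g), X' \<otimes>\<^sub>o\<^bsub>C\<^esub> Y')),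
     Unit = Unit C,
     Assoc = (\<lambda>X Y Z. kleisli_embed C \<eta> (Assoc C X Y Z)),
     Lunit = (\<lambda>X. kleisli_embed C \<eta> (Lunit C X)),
     Runit = (\<lambda>X. kleisli_embed C \<eta> (Runit C X)),
     Braid = (\<lambda>X Y. kleisli_embed C \<eta> (Braid C X Y)),
     Dup = (\<lambda>X. (X, \<eta> (X \<otimes>\<^sub>o\<^bsub>C\<^esub> X) \<cdot>\<^bsub>C\<^esub> \<nabla>\<^bsub>C\<^esub> X, X \<otimes>\<^sub>o\<^bsub>C\<^esub> X)),
     Del = (\<lambda>X. (X, \<eta> \<I>\<^bsub>C\<^esub> \<cdot>\<^bsub>C\<^esub> !\<^bsub>C\<^esub> X, \<I>\<^bsub>C\<^esub>)),
     Leq = (\<lambda>(X, f, Y) (X', g, Y'). X = X' \<and> Y = Y' \<and> f \<preceq>\<^bsub>C\<^esub> g) \<rparr>"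

end

theory Submission
  imports Defs
begin

text \<open>
  Write \<open>K\<close> for the Kleisli category and \<open>J f = \<eta> \<cdot> f\<close> for the free functor from \<open>C\<close> to \<open>K\<close>, the
  identity on objects. Composition in \<open>K\<close> with an arrow from the image of \<open>J\<close> needs no \<open>\<mu>\<close>: by the
  unit laws of the monad, postcomposing \<open>f : X \<rightarrow> T Y\<close> with \<open>J h\<close> gives \<open>T h \<cdot> f\<close>, and precomposing
  gives \<open>f \<cdot> h\<close> (\<open>J_postcomp\<close>, \<open>J_precomp\<close>). Since \<open>\<eta>\<close> is a monoidal transformation, \<open>J\<close> preserves
  the tensor strictly (\<open>J_tensor\<close>).

  Everything structural in \<open>K\<close> (associator, unitors, braiding, \<open>\<nabla>\<close>, \<open>!\<close>) is by definition the
  \<open>J\<close>-image of its counterpart in \<open>C\<close>. Hence every axiom that only relates structural arrows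
  (pentagon, triangle, hexagon, symmetry, the comonoid laws, the laws for \<open>\<nabla>\<close> and \<open>!\<close> on tensors)
  is the \<open>J\<close>-image of the same axiom of \<open>C\<close>. What remains for the monoidal structure are the axioms
  about arbitrary Kleisli arrows: the interchange law, which rests on the compatibility of \<open>\<mu>\<close> with \<open>c\<close>,
  and the four naturality laws, each of which is one of the coherence laws of the lax monoidal
  functor \<open>T\<close> followed by naturality in \<open>C\<close>. The order is compatible with composition and tensor
  because \<open>T\<close> is monotone.

  The two oplax inequalities for \<open>f : X \<rightarrow> T Y\<close> then combine the colax law of \<open>T\<close> with the
  inequality of \<open>C\<close> for \<open>f\<close>, regarded as an arrow of \<open>C\<close>:
  \<open>T (\<nabla> Y) \<cdot> f \<preceq> c Y Y \<cdot> \<nabla> (T Y) \<cdot> f \<preceq> c Y Y \<cdot> (f \<otimes> f) \<cdot> \<nabla> X\<close> and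
  \<open>T (! Y) \<cdot> f \<preceq> u \<cdot> ! (T Y) \<cdot> f \<preceq> u \<cdot> ! X\<close>.
  The outer terms are the two sides of the required inequalities in \<open>K\<close>, computed by
  \<open>J_postcomp\<close> and \<open>J_precomp\<close>; for deletion, also \<open>u = \<eta>\<close> at the unit object is used.
\<close>

section \<open>Typing of arrows by domain and codomain\<close>

text \<open>
  The axioms are stated for arrows of a given hom-set, so as rewrite rules their premises contain
  objects that do not occur in the term being rewritten. Restated with \<open>Arr\<close>, \<open>Dom\<close> and \<open>Cod\<close>, the
  side conditions are determined by the term, and the simplifier can type composites itself.
\<close>

lemma hom_iff: "f \<in> hom C X Y \<longleftrightarrow> f \<in> Arr C \<and> Dom C f = X \<and> Cod C f = Y"
  by (auto simp: hom_def)

context category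
begin

lemmas [simp] = dom_closed cod_closed

lemma ident_simps [simp]:
  assumes "X \<in> Obj C"
  shows "Ident C X \<in> Arr C" "Dom C (Ident C X) = X" "Cod C (Ident C X) = X"
  using id_in_hom[OF assms] by (auto simp: hom_iff)

lemma comp_simps [simp]:
  assumes "f \<in> Arr C" "g \<in> Arr C" "Dom C g = Cod C f"
  shows "g \<cdot> f \<in> Arr C" "Dom C (g \<cdot> f) = Dom C f" "Cod C (g \<cdot> f) = Cod C g"
  using comp_in_hom[of f "Dom C f" "Cod C f" g "Cod C g"] assms by (auto simp: hom_iff)

lemma comp_assoc_simp [simp]:
  assumes "f \<in> Arr C" "g \<in> Arr C" "h \<in> Arr C" "Dom C g = Cod C f" "Dom C h = Cod C g"
  shows "(h \<cdot> g) \<cdot> f = h \<cdot> g \<cdot> f"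
  using comp_assoc[of f "Dom C f" "Cod C f" g "Cod C g" h "Cod C h"] assms by (simp add: hom_iff)

lemma comp_ident_simps [simp]:
  assumes "f \<in> Arr C"
  shows "Y = Cod C f \<Longrightarrow> Ident C Y \<cdot> f = f" "X = Dom C f \<Longrightarrow> f \<cdot> Ident C X = f"
  using comp_id_left[of f "Dom C f" "Cod C f"] comp_id_right[of f "Dom C f" "Cod C f"] assms
  by (auto simp: hom_iff)

lemma inverse_arrows_unique:
  assumes "inverse_arrows C f g" and "inverse_arrows C f h"
  shows "g = h"
proof -
  have "g = (h \<cdot> f) \<cdot> g"
    using assms by (simp add: inverse_arrows_def hom_iff)
  also have "\<dots> = h \<cdot> (f \<cdot> g)"
    using assms unfolding inverse_arrows_def hom_iff by (intro comp_assoc_simp) auto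
  also have "\<dots> = h"
    using assms by (simp add: inverse_arrows_def hom_iff)
  finally show ?thesis .
qed

lemma inv_arrow_eqI: "inverse_arrows C f g \<Longrightarrow> inv_arrow C f = g"
  unfolding inv_arrow_def by (rule the_equality) (auto intro: inverse_arrows_unique)

lemma inverse_arrows_inv_arrow: "iso C f \<Longrightarrow> inverse_arrows C f (inv_arrow C f)"
  unfolding iso_def using inv_arrow_eqI by auto

lemma inv_arrow_simps [simp]:
  assumes "iso C f"
  shows "inv_arrow C f \<in> Arr C" "Dom C (inv_arrow C f) = Cod C f" "Cod C (inv_arrow C f) = Dom C f"
  using inverse_arrows_inv_arrow[OF assms] by (auto simp: inverse_arrows_def hom_iff)

end

context symmetric_monoidal_category
begin

lemmas [simp] = unit_obj tensor_obj assoc_iso lunit_iso runit_iso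

lemma tensor_simps [simp]:
  assumes "f \<in> Arr C" "g \<in> Arr C"
  shows "f \<otimes> g \<in> Arr C" "Dom C (f \<otimes> g) = Dom C f \<otimes>\<^sub>o Dom C g"
    "Cod C (f \<otimes> g) = Cod C f \<otimes>\<^sub>o Cod C g"
  using tensor_in_hom[of f "Dom C f" "Cod C f" g "Dom C g" "Cod C g"] assms by (auto simp: hom_iff)

lemma assoc_simps [simp]:
  assumes "X \<in> Obj C" "Y \<in> Obj C" "Z \<in> Obj C"
  shows "Assoc C X Y Z \<in> Arr C" "Dom C (Assoc C X Y Z) = (X \<otimes>\<^sub>o Y) \<otimes>\<^sub>o Z"
    "Cod C (Assoc C X Y Z) = X \<otimes>\<^sub>o (Y \<otimes>\<^sub>o Z)"
  using assoc_in_hom[OF assms] by (auto simp: hom_iff)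

lemma lunit_simps [simp]:
  assumes "X \<in> Obj C"
  shows "Lunit C X \<in> Arr C" "Dom C (Lunit C X) = \<I> \<otimes>\<^sub>o X" "Cod C (Lunit C X) = X"
  using lunit_in_hom[OF assms] by (auto simp: hom_iff)

lemma runit_simps [simp]:
  assumes "X \<in> Obj C"
  shows "Runit C X \<in> Arr C" "Dom C (Runit C X) = X \<otimes>\<^sub>o \<I>" "Cod C (Runit C X) = X"
  using runit_in_hom[OF assms] by (auto simp: hom_iff)

lemma braid_simps [simp]:
  assumes "X \<in> Obj C" "Y \<in> Obj C"
  shows "Braid C X Y \<in> Arr C" "Dom C (Braid C X Y) = X \<otimes>\<^sub>o Y" "Cod C (Braid C X Y) = Y \<otimes>\<^sub>o X"
  using braid_in_hom[OF assms] by (auto simp: hom_iff)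

text \<open>
  The direction that merges two tensors: unlike \<open>tensor_comp\<close>, its left-hand side also matches when
  one of the factors is an identity, so it slides arrows past each other.
\<close>

lemma interchange:
  assumes "f \<in> Arr C" "f' \<in> Arr C" "g \<in> Arr C" "g' \<in> Arr C"
    and "Dom C f' = Cod C f" "Dom C g' = Cod C g"
  shows "(f' \<otimes> g') \<cdot> (f \<otimes> g) = (f' \<cdot> f) \<otimes> (g' \<cdot> g)"
  using tensor_comp[of f "Dom C f" "Cod C f" f' "Cod C f'" g "Dom C g" "Cod C g" g' "Cod C g'"] assms
  by (simp add: hom_iff)

end

context gs_monoidal_category
begin

lemma dup_simps [simp]:
  assumes "X \<in> Obj C"
  shows "\<nabla> X \<in> Arr C" "Dom C (\<nabla> X) = X" "Cod C (\<nabla> X) = X \<otimes>\<^sub>o X"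
  using dup_in_hom[OF assms] by (auto simp: hom_iff)

lemma del_simps [simp]:
  assumes "X \<in> Obj C"
  shows "Del C X \<in> Arr C" "Dom C (Del C X) = X" "Cod C (Del C X) = \<I>"
  using del_in_hom[OF assms] by (auto simp: hom_iff)

end

context preorder_enriched_gs_monoidal_category
begin

lemma leq_refl [simp]: "f \<in> Arr C \<Longrightarrow> f \<preceq> f"
  using reflp_onD[OF hom_refl[of "Dom C f" "Cod C f"]] by (simp add: hom_iff)

lemma leq_trans:
  assumes "f \<preceq> g" "g \<preceq> h" "f \<in> hom C X Y" "g \<in> hom C X Y" "h \<in> hom C X Y"
  shows "f \<preceq> h"
proof -
  have "X \<in> Obj C" "Y \<in> Obj C"
    using assms(3) dom_closed cod_closed by (auto simp: hom_def)
  then show ?thesis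
    using transp_onD[OF hom_trans] assms by blast
qed

lemma comp_mono_arr:
  assumes "f \<preceq> f'" "g \<preceq> g'" "f \<in> Arr C" "f' \<in> Arr C" "g \<in> Arr C" "g' \<in> Arr C"
    and "Dom C f' = Dom C f" "Cod C f' = Cod C f" "Dom C g' = Dom C g" "Cod C g' = Cod C g"
    and "Dom C g = Cod C f"
  shows "g \<cdot> f \<preceq> g' \<cdot> f'"
  using comp_mono[of f "Dom C f" "Cod C f" f' g "Cod C g" g'] assms by (simp add: hom_iff)

lemma tensor_mono_arr:
  assumes "f \<preceq> f'" "g \<preceq> g'" "f \<in> Arr C" "f' \<in> Arr C" "g \<in> Arr C" "g' \<in> Arr C"
    and "Dom C f' = Dom C f" "Cod C f' = Cod C f" "Dom C g' = Dom C g" "Cod C g' = Cod C g"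
  shows "f \<otimes> g \<preceq> f' \<otimes> g'"
  using tensor_mono[of f "Dom C f" "Cod C f" f' g "Dom C g" "Cod C g" g'] assms by (simp add: hom_iff)

end

context symmetric_monoidal_monad
begin

lemmas [simp] = functor_obj

lemma functor_simps [simp]:
  assumes "f \<in> Arr C"
  shows "T\<^sub>a f \<in> Arr C" "Dom C (T\<^sub>a f) = T\<^sub>o (Dom C f)" "Cod C (T\<^sub>a f) = T\<^sub>o (Cod C f)"
  using functor_in_hom[of f "Dom C f" "Cod C f"] assms by (auto simp: hom_iff)

lemma functor_comp_simp [simp]:
  assumes "f \<in> Arr C" "g \<in> Arr C" "Dom C g = Cod C f"
  shows "T\<^sub>a (g \<cdot> f) = T\<^sub>a g \<cdot> T\<^sub>a f"
  using functor_comp[of f "Dom C f" "Cod C f" g "Cod C g"] assms by (simp add: hom_iff)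

lemma mu_simps [simp]:
  assumes "X \<in> Obj C"
  shows "\<mu> X \<in> Arr C" "Dom C (\<mu> X) = T\<^sub>o (T\<^sub>o X)" "Cod C (\<mu> X) = T\<^sub>o X"
  using mu_in_hom[OF assms] by (auto simp: hom_iff)

lemma eta_simps [simp]:
  assumes "X \<in> Obj C"
  shows "\<eta> X \<in> Arr C" "Dom C (\<eta> X) = X" "Cod C (\<eta> X) = T\<^sub>o X"
  using eta_in_hom[OF assms] by (auto simp: hom_iff)

lemma lax_simps [simp]:
  assumes "X \<in> Obj C" "Y \<in> Obj C"
  shows "c X Y \<in> Arr C" "Dom C (c X Y) = T\<^sub>o X \<otimes>\<^sub>o T\<^sub>o Y" "Cod C (c X Y) = T\<^sub>o (X \<otimes>\<^sub>o Y)"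
  using lax_in_hom[OF assms] by (auto simp: hom_iff)

lemma mu_natural_arr:
  assumes "f \<in> Arr C"
  shows "\<mu> (Cod C f) \<cdot> T\<^sub>a (T\<^sub>a f) = T\<^sub>a f \<cdot> \<mu> (Dom C f)"
  using mu_natural[of f] assms by (simp add: hom_iff)

lemma eta_natural_arr:
  assumes "f \<in> Arr C"
  shows "\<eta> (Cod C f) \<cdot> f = T\<^sub>a f \<cdot> \<eta> (Dom C f)"
  using eta_natural[of f] assms by (simp add: hom_iff)

lemma lax_natural_arr:
  assumes "f \<in> Arr C" "g \<in> Arr C"
  shows "c (Cod C f) (Cod C g) \<cdot> (T\<^sub>a f \<otimes> T\<^sub>a g) = T\<^sub>a (f \<otimes> g) \<cdot> c (Dom C f) (Dom C g)"
  using lax_natural[of f "Dom C f" "Cod C f" g "Dom C g" "Cod C g"] assms by (simp add: hom_iff)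

end

section \<open>The Kleisli category\<close>

text \<open>
  The record \<open>C\<close> carries comonoids and an order because \<open>Kleisli\<close> transports them; their laws are
  premises of the lemmas about duplication, deletion and the order.
\<close>

locale kleisli_construction = symmetric_monoidal_monad C T\<^sub>o T\<^sub>a \<mu> \<eta> c u
  for C :: "('o, 'a) pgs_data" (structure)
    and T\<^sub>o T\<^sub>a \<mu> \<eta> c u
begin

abbreviation K where "K \<equiv> Kleisli C T\<^sub>o T\<^sub>a \<mu> \<eta> c"

abbreviation J where "J \<equiv> kleisli_embed C \<eta>"

lemma kleisli_fields [simp]:
  "Obj K = Obj C"
  "Dom K (X, f, Y) = X"
  "Cod K (X, f, Y) = Y"
  "Ident K X = (X, \<eta> X, X)"
  "Comp K (Y, g, Z) (X, f, Y') = (X, \<mu> Z \<cdot> T\<^sub>a g \<cdot> f, Z)"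
  "TensO K = TensO C"
  "TensA K (X, f, X') (Y, g, Y') = (X \<otimes>\<^sub>o Y, c X' Y' \<cdot> (f \<otimes> g), X' \<otimes>\<^sub>o Y')"
  "Unit K = \<I>"
  "Assoc K X Y Z = J (Assoc C X Y Z)"
  "Lunit K X = J (Lunit C X)"
  "Runit K X = J (Runit C X)"
  "Braid K X Y = J (Braid C X Y)"
  "Leq K (X, f, Y) (X', g, Y') \<longleftrightarrow> X = X' \<and> Y = Y' \<and> f \<preceq> g"
  by (simp_all add: Kleisli_def)

lemma kleisli_arr_iff [simp]:
  "(X, f, Y) \<in> Arr K \<longleftrightarrow> X \<in> Obj C \<and> Y \<in> Obj C \<and> f \<in> Arr C \<and> Dom C f = X \<and> Cod C f = T\<^sub>o Y"
  by (simp add: Kleisli_def hom_iff)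

lemma kleisli_homE:
  assumes "F \<in> hom K X Y"
  obtains f where "F = (X, f, Y)" "X \<in> Obj C" "Y \<in> Obj C" "f \<in> Arr C" "Dom C f = X" "Cod C f = T\<^sub>o Y"
  using assms by (cases F) (auto simp: hom_iff)

lemma kleisli_category: "category K"
proof
  show "Dom K F \<in> Obj K" if "F \<in> Arr K" for F using that by (cases F) auto
  show "Cod K F \<in> Obj K" if "F \<in> Arr K" for F using that by (cases F) auto
  show "Ident K X \<in> hom K X X" if "X \<in> Obj K" for X using that by (simp add: hom_iff)
  show "G \<cdot>\<^bsub>K\<^esub> F \<in> hom K X Z" if "F \<in> hom K X Y" "G \<in> hom K Y Z" for F G X Y Z
    using that by (elim kleisli_homE) (simp add: hom_iff)
  show "Ident K Y \<cdot>\<^bsub>K\<^esub> F = F" if F: "F \<in> hom K X Y" for F X Y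
  proof -
    obtain f where [simp]: "F = (X, f, Y)" "X \<in> Obj C" "Y \<in> Obj C" "f \<in> Arr C"
      "Dom C f = X" "Cod C f = T\<^sub>o Y"
      using F by (rule kleisli_homE)
    have "\<mu> Y \<cdot> T\<^sub>a (\<eta> Y) \<cdot> f = (\<mu> Y \<cdot> T\<^sub>a (\<eta> Y)) \<cdot> f"
      by simp
    also have "\<dots> = f"
      by (simp add: monad_unit_right del: comp_assoc_simp)
    finally show ?thesis by simp
  qed
  show "F \<cdot>\<^bsub>K\<^esub> Ident K X = F" if F: "F \<in> hom K X Y" for F X Y
  proof -
    obtain f where [simp]: "F = (X, f, Y)" "X \<in> Obj C" "Y \<in> Obj C" "f \<in> Arr C"
      "Dom C f = X" "Cod C f = T\<^sub>o Y"
      using F by (rule kleisli_homE)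
    have "\<mu> Y \<cdot> T\<^sub>a f \<cdot> \<eta> X = (\<mu> Y \<cdot> \<eta> (T\<^sub>o Y)) \<cdot> f"
      using eta_natural_arr[of f] by simp
    also have "\<dots> = f"
      by (simp add: monad_unit_left del: comp_assoc_simp)
    finally show ?thesis by simp
  qed
  show "(H \<cdot>\<^bsub>K\<^esub> G) \<cdot>\<^bsub>K\<^esub> F = H \<cdot>\<^bsub>K\<^esub> (G \<cdot>\<^bsub>K\<^esub> F)"
    if arrows: "F \<in> hom K X Y" "G \<in> hom K Y Z" "H \<in> hom K Z W" for F G H X Y Z W
  proof -
    obtain f where [simp]: "F = (X, f, Y)" "X \<in> Obj C" "Y \<in> Obj C" "f \<in> Arr C"
      "Dom C f = X" "Cod C f = T\<^sub>o Y"
      using arrows(1) by (rule kleisli_homE)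
    obtain g where [simp]: "G = (Y, g, Z)" "Z \<in> Obj C" "g \<in> Arr C" "Dom C g = Y" "Cod C g = T\<^sub>o Z"
      using arrows(2) by (rule kleisli_homE)
    obtain h where [simp]: "H = (Z, h, W)" "W \<in> Obj C" "h \<in> Arr C" "Dom C h = Z" "Cod C h = T\<^sub>o W"
      using arrows(3) by (rule kleisli_homE)
    have "\<mu> W \<cdot> T\<^sub>a (\<mu> W \<cdot> T\<^sub>a h \<cdot> g) \<cdot> f = (\<mu> W \<cdot> T\<^sub>a (\<mu> W)) \<cdot> T\<^sub>a (T\<^sub>a h) \<cdot> T\<^sub>a g \<cdot> f"
      by simp
    also have "\<dots> = \<mu> W \<cdot> (\<mu> (T\<^sub>o W) \<cdot> T\<^sub>a (T\<^sub>a h)) \<cdot> T\<^sub>a g \<cdot> f"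
      unfolding monad_assoc[OF \<open>W \<in> Obj C\<close>] by simp
    also have "\<dots> = \<mu> W \<cdot> T\<^sub>a h \<cdot> \<mu> Z \<cdot> T\<^sub>a g \<cdot> f"
      using mu_natural_arr[of h] by (simp del: comp_assoc_simp) simp
    finally show ?thesis by simp
  qed
qed

section \<open>The free functor\<close>

lemma J_in_arr [simp]: "f \<in> Arr C \<Longrightarrow> J f \<in> Arr K"
  by (simp add: kleisli_embed_def)

lemma J_dom_cod [simp]: "Dom K (J f) = Dom C f" "Cod K (J f) = Cod C f"
  by (simp_all add: kleisli_embed_def)

text \<open>Turned towards \<open>J\<close>, so that equations between structural arrows collapse into the image of \<open>J\<close>.\<close>

lemma J_ident: "X \<in> Obj C \<Longrightarrow> (X, \<eta> X, X) = J (Ident C X)"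
  by (simp add: kleisli_embed_def)

text \<open>The factor \<open>T \<eta>\<close> coming from \<open>J h\<close> cancels \<open>\<mu>\<close>.\<close>

lemma J_postcomp:
  assumes "f \<in> Arr C" "Cod C f = T\<^sub>o Y" "h \<in> Arr C" "Dom C h = Y"
  shows "J h \<cdot>\<^bsub>K\<^esub> (X, f, Y) = (X, T\<^sub>a h \<cdot> f, Cod C h)"
proof -
  have "\<mu> (Cod C h) \<cdot> T\<^sub>a (\<eta> (Cod C h) \<cdot> h) \<cdot> f = (\<mu> (Cod C h) \<cdot> T\<^sub>a (\<eta> (Cod C h))) \<cdot> T\<^sub>a h \<cdot> f"
    using assms by simp
  also have "\<dots> = T\<^sub>a h \<cdot> f"
    using assms by (simp add: monad_unit_right del: comp_assoc_simp)
  finally show ?thesis by (simp add: kleisli_embed_def)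
qed

text \<open>Naturality of \<open>\<eta>\<close> moves it to the left of \<open>f\<close>, where it cancels \<open>\<mu>\<close>.\<close>

lemma J_precomp:
  assumes "f \<in> Arr C" "Dom C f = X" "Cod C f = T\<^sub>o Y" "Y \<in> Obj C" "h \<in> Arr C" "Cod C h = X"
  shows "(X, f, Y) \<cdot>\<^bsub>K\<^esub> J h = (Dom C h, f \<cdot> h, Y)"
proof -
  note [simp] = assms
  have [simp]: "X \<in> Obj C"
    using assms dom_closed by blast
  have "\<mu> Y \<cdot> T\<^sub>a f \<cdot> \<eta> X \<cdot> h = \<mu> Y \<cdot> (T\<^sub>a f \<cdot> \<eta> X) \<cdot> h"
    by simp
  also have "T\<^sub>a f \<cdot> \<eta> X = \<eta> (T\<^sub>o Y) \<cdot> f"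
    using eta_natural_arr[of f] by simp
  also have "\<mu> Y \<cdot> (\<eta> (T\<^sub>o Y) \<cdot> f) \<cdot> h = (\<mu> Y \<cdot> \<eta> (T\<^sub>o Y)) \<cdot> f \<cdot> h"
    by simp
  also have "\<dots> = f \<cdot> h"
    by (simp add: monad_unit_left del: comp_assoc_simp)
  finally show ?thesis by (simp add: kleisli_embed_def)
qed

lemma J_comp:
  assumes "f \<in> Arr C" "g \<in> Arr C" "Dom C g = Cod C f"
  shows "J g \<cdot>\<^bsub>K\<^esub> J f = J (g \<cdot> f)"
proof -
  have "J g \<cdot>\<^bsub>K\<^esub> J f = (Dom C g, \<eta> (Cod C g) \<cdot> g, Cod C g) \<cdot>\<^bsub>K\<^esub> J f"
    by (simp only: kleisli_embed_def)
  also have "\<dots> = (Dom C f, (\<eta> (Cod C g) \<cdot> g) \<cdot> f, Cod C g)"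
    by (rule J_precomp) (use assms in simp_all)
  also have "\<dots> = J (g \<cdot> f)"
    using assms by (simp add: kleisli_embed_def)
  finally show ?thesis .
qed

text \<open>This is the law \<open>c \<cdot> (\<eta> \<otimes> \<eta>) = \<eta>\<close> after splitting the tensor of composites.\<close>

lemma J_tensor:
  assumes "f \<in> Arr C" "g \<in> Arr C"
  shows "J f \<otimes>\<^bsub>K\<^esub> J g = J (f \<otimes> g)"
proof -
  let ?X = "Cod C f" and ?Y = "Cod C g"
  have "c ?X ?Y \<cdot> ((\<eta> ?X \<cdot> f) \<otimes> (\<eta> ?Y \<cdot> g)) = (c ?X ?Y \<cdot> (\<eta> ?X \<otimes> \<eta> ?Y)) \<cdot> (f \<otimes> g)"
    using assms by (simp add: interchange)
  also have "\<dots> = \<eta> (?X \<otimes>\<^sub>o ?Y) \<cdot> (f \<otimes> g)"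
    using assms by (simp add: eta_monoidal del: comp_assoc_simp)
  finally show ?thesis using assms by (simp add: kleisli_embed_def)
qed

lemma J_inverse_arrows:
  assumes "inverse_arrows C f g"
  shows "inverse_arrows K (J f) (J g)"
  using assms by (auto simp: inverse_arrows_def hom_iff J_comp J_ident)

lemma J_iso: "iso C f \<Longrightarrow> iso K (J f)"
  unfolding iso_def using J_inverse_arrows by blast

text \<open>
  The laws for \<open>\<nabla>\<close> on tensors and on the unit mention inverses of coherence isomorphisms, and
  \<open>inv_arrow\<close> is a definite description; uniqueness of inverses in \<open>K\<close> identifies it.
\<close>

lemma J_inv_arrow: "iso C f \<Longrightarrow> inv_arrow K (J f) = J (inv_arrow C f)"
  by (intro category.inv_arrow_eqI[OF kleisli_category] J_inverse_arrows inverse_arrows_inv_arrow)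

lemmas J_simps = J_ident J_comp J_tensor J_inv_arrow

lemma J_middle_swap:
  assumes "X \<in> Obj C" "Y \<in> Obj C"
  shows "middle_swap K X Y = J (middle_swap C X Y)"
  using assms by (simp add: middle_swap_def J_simps)

section \<open>The symmetric monoidal structure\<close>

text \<open>
  Functoriality of the Kleisli tensor. Compatibility of \<open>\<mu>\<close> with \<open>c\<close> trades \<open>\<mu> \<otimes> \<mu>\<close> for a single
  \<open>\<mu>\<close> at the cost of a second \<open>c\<close>, and naturality of that \<open>c\<close> carries it past \<open>T f' \<otimes> T g'\<close>.
\<close>

lemma kleisli_interchange:
  assumes "f \<in> Arr C" "Cod C f = T\<^sub>o X'" "f' \<in> Arr C" "Dom C f' = X'" "Cod C f' = T\<^sub>o X''"
    and "g \<in> Arr C" "Cod C g = T\<^sub>o Y'" "g' \<in> Arr C" "Dom C g' = Y'" "Cod C g' = T\<^sub>o Y''"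
    and "X' \<in> Obj C" "X'' \<in> Obj C" "Y' \<in> Obj C" "Y'' \<in> Obj C"
  shows "c X'' Y'' \<cdot> ((\<mu> X'' \<cdot> T\<^sub>a f' \<cdot> f) \<otimes> (\<mu> Y'' \<cdot> T\<^sub>a g' \<cdot> g)) =
    \<mu> (X'' \<otimes>\<^sub>o Y'') \<cdot> T\<^sub>a (c X'' Y'' \<cdot> (f' \<otimes> g')) \<cdot> c X' Y' \<cdot> (f \<otimes> g)"
proof -
  note [simp] = assms
  have "c X'' Y'' \<cdot> ((\<mu> X'' \<cdot> T\<^sub>a f' \<cdot> f) \<otimes> (\<mu> Y'' \<cdot> T\<^sub>a g' \<cdot> g)) =
      (c X'' Y'' \<cdot> (\<mu> X'' \<otimes> \<mu> Y'')) \<cdot> (T\<^sub>a f' \<otimes> T\<^sub>a g') \<cdot> (f \<otimes> g)"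
    by (simp add: interchange)
  also have "\<dots> = \<mu> (X'' \<otimes>\<^sub>o Y'') \<cdot> T\<^sub>a (c X'' Y'') \<cdot>
      (c (T\<^sub>o X'') (T\<^sub>o Y'') \<cdot> (T\<^sub>a f' \<otimes> T\<^sub>a g')) \<cdot> (f \<otimes> g)"
    by (simp flip: mu_monoidal)
  also have "c (T\<^sub>o X'') (T\<^sub>o Y'') \<cdot> (T\<^sub>a f' \<otimes> T\<^sub>a g') = T\<^sub>a (f' \<otimes> g') \<cdot> c X' Y'"
    using lax_natural_arr[of f' g'] by simp
  finally show ?thesis by simp
qed

text \<open>
  In the next four lemmas the two sides are the Kleisli composites of a tensor of Kleisli arrows
  with a coherence isomorphism, as given by \<open>J_postcomp\<close> and \<open>J_precomp\<close>. The coherence law of \<open>c\<close>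
  turns \<open>T\<close> of the isomorphism into the isomorphism at \<open>T X\<close>, which is natural in \<open>C\<close>.
\<close>

lemma kleisli_assoc_natural:
  assumes "f \<in> Arr C" "Cod C f = T\<^sub>o X" "g \<in> Arr C" "Cod C g = T\<^sub>o Y" "h \<in> Arr C" "Cod C h = T\<^sub>o Z"
    and "X \<in> Obj C" "Y \<in> Obj C" "Z \<in> Obj C"
  shows "T\<^sub>a (Assoc C X Y Z) \<cdot> c (X \<otimes>\<^sub>o Y) Z \<cdot> ((c X Y \<cdot> (f \<otimes> g)) \<otimes> h) =
    (c X (Y \<otimes>\<^sub>o Z) \<cdot> (f \<otimes> (c Y Z \<cdot> (g \<otimes> h)))) \<cdot> Assoc C (Dom C f) (Dom C g) (Dom C h)"
proof -
  note [simp] = assms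
  have "T\<^sub>a (Assoc C X Y Z) \<cdot> c (X \<otimes>\<^sub>o Y) Z \<cdot> ((c X Y \<cdot> (f \<otimes> g)) \<otimes> h) =
      (T\<^sub>a (Assoc C X Y Z) \<cdot> c (X \<otimes>\<^sub>o Y) Z \<cdot> (c X Y \<otimes> Ident C (T\<^sub>o Z))) \<cdot> ((f \<otimes> g) \<otimes> h)"
    by (simp add: interchange)
  also have "\<dots> = c X (Y \<otimes>\<^sub>o Z) \<cdot> (Ident C (T\<^sub>o X) \<otimes> c Y Z) \<cdot>
      (Assoc C (T\<^sub>o X) (T\<^sub>o Y) (T\<^sub>o Z) \<cdot> ((f \<otimes> g) \<otimes> h))"
    by (subst lax_assoc) simp_all
  also have "Assoc C (T\<^sub>o X) (T\<^sub>o Y) (T\<^sub>o Z) \<cdot> ((f \<otimes> g) \<otimes> h) =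
      (f \<otimes> (g \<otimes> h)) \<cdot> Assoc C (Dom C f) (Dom C g) (Dom C h)"
    by (rule assoc_natural) (simp_all add: hom_iff)
  also have "c X (Y \<otimes>\<^sub>o Z) \<cdot> (Ident C (T\<^sub>o X) \<otimes> c Y Z) \<cdot> (f \<otimes> (g \<otimes> h)) \<cdot>
        Assoc C (Dom C f) (Dom C g) (Dom C h) =
      c X (Y \<otimes>\<^sub>o Z) \<cdot> ((Ident C (T\<^sub>o X) \<otimes> c Y Z) \<cdot> (f \<otimes> (g \<otimes> h))) \<cdot>
        Assoc C (Dom C f) (Dom C g) (Dom C h)"
    by simp
  also have "(Ident C (T\<^sub>o X) \<otimes> c Y Z) \<cdot> (f \<otimes> (g \<otimes> h)) = f \<otimes> (c Y Z \<cdot> (g \<otimes> h))"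
    by (simp add: interchange)
  finally show ?thesis by simp
qed

lemma kleisli_lunit_natural:
  assumes "f \<in> Arr C" "Cod C f = T\<^sub>o Y" "Y \<in> Obj C"
  shows "T\<^sub>a (Lunit C Y) \<cdot> c \<I> Y \<cdot> (\<eta> \<I> \<otimes> f) = f \<cdot> Lunit C (Dom C f)"
proof -
  note [simp] = assms
  have "T\<^sub>a (Lunit C Y) \<cdot> c \<I> Y \<cdot> (\<eta> \<I> \<otimes> f) =
      (T\<^sub>a (Lunit C Y) \<cdot> c \<I> Y \<cdot> (\<eta> \<I> \<otimes> Ident C (T\<^sub>o Y))) \<cdot> (Ident C \<I> \<otimes> f)"
    by (simp add: interchange)
  also have "\<dots> = Lunit C (T\<^sub>o Y) \<cdot> (Ident C \<I> \<otimes> f)"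
    using lax_unit_left[of Y] by (simp add: unit_eq_eta del: comp_assoc_simp)
  also have "\<dots> = f \<cdot> Lunit C (Dom C f)"
    by (rule lunit_natural) (simp add: hom_iff)
  finally show ?thesis .
qed

lemma kleisli_runit_natural:
  assumes "f \<in> Arr C" "Cod C f = T\<^sub>o Y" "Y \<in> Obj C"
  shows "T\<^sub>a (Runit C Y) \<cdot> c Y \<I> \<cdot> (f \<otimes> \<eta> \<I>) = f \<cdot> Runit C (Dom C f)"
proof -
  note [simp] = assms
  have "T\<^sub>a (Runit C Y) \<cdot> c Y \<I> \<cdot> (f \<otimes> \<eta> \<I>) =
      (T\<^sub>a (Runit C Y) \<cdot> c Y \<I> \<cdot> (Ident C (T\<^sub>o Y) \<otimes> \<eta> \<I>)) \<cdot> (f \<otimes> Ident C \<I>)"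
    by (simp add: interchange)
  also have "\<dots> = Runit C (T\<^sub>o Y) \<cdot> (f \<otimes> Ident C \<I>)"
    using lax_unit_right[of Y] by (simp add: unit_eq_eta del: comp_assoc_simp)
  also have "\<dots> = f \<cdot> Runit C (Dom C f)"
    by (rule runit_natural) (simp add: hom_iff)
  finally show ?thesis .
qed

lemma kleisli_braid_natural:
  assumes "f \<in> Arr C" "Cod C f = T\<^sub>o X" "g \<in> Arr C" "Cod C g = T\<^sub>o Y" "X \<in> Obj C" "Y \<in> Obj C"
  shows "T\<^sub>a (Braid C X Y) \<cdot> c X Y \<cdot> (f \<otimes> g) = (c Y X \<cdot> (g \<otimes> f)) \<cdot> Braid C (Dom C f) (Dom C g)"
proof -
  note [simp] = assms
  have "T\<^sub>a (Braid C X Y) \<cdot> c X Y \<cdot> (f \<otimes> g) = (T\<^sub>a (Braid C X Y) \<cdot> c X Y) \<cdot> (f \<otimes> g)"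
    by simp
  also have "\<dots> = c Y X \<cdot> (Braid C (T\<^sub>o X) (T\<^sub>o Y) \<cdot> (f \<otimes> g))"
    by (subst lax_symmetric) simp_all
  also have "Braid C (T\<^sub>o X) (T\<^sub>o Y) \<cdot> (f \<otimes> g) = (g \<otimes> f) \<cdot> Braid C (Dom C f) (Dom C g)"
    by (rule braid_natural) (simp_all add: hom_iff)
  finally show ?thesis by simp
qed

lemma kleisli_symmetric_monoidal: "symmetric_monoidal_category K"
proof -
  interpret K: category K by (rule kleisli_category)
  show ?thesis
  proof
    show "Unit K \<in> Obj K" by simp
    show "X \<otimes>\<^sub>o\<^bsub>K\<^esub> Y \<in> Obj K" if "X \<in> Obj K" "Y \<in> Obj K" for X Y
      using that by simp
    show "F \<otimes>\<^bsub>K\<^esub> G \<in> hom K (X \<otimes>\<^sub>o\<^bsub>K\<^esub> Y) (X' \<otimes>\<^sub>o\<^bsub>K\<^esub> Y')"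
      if "F \<in> hom K X X'" "G \<in> hom K Y Y'" for F G X X' Y Y'
      using that by (elim kleisli_homE) (simp add: hom_iff)
    show "Ident K X \<otimes>\<^bsub>K\<^esub> Ident K Y = Ident K (X \<otimes>\<^sub>o\<^bsub>K\<^esub> Y)" if "X \<in> Obj K" "Y \<in> Obj K" for X Y
      using that by (simp add: eta_monoidal)
    show "(F' \<cdot>\<^bsub>K\<^esub> F) \<otimes>\<^bsub>K\<^esub> (G' \<cdot>\<^bsub>K\<^esub> G) = (F' \<otimes>\<^bsub>K\<^esub> G') \<cdot>\<^bsub>K\<^esub> (F \<otimes>\<^bsub>K\<^esub> G)"
      if "F \<in> hom K X X'" "F' \<in> hom K X' X''" "G \<in> hom K Y Y'" "G' \<in> hom K Y' Y''"
      for F F' G G' X X' X'' Y Y' Y''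
      using that by (elim kleisli_homE) (simp add: kleisli_interchange)
    show "Assoc K X Y Z \<in> hom K ((X \<otimes>\<^sub>o\<^bsub>K\<^esub> Y) \<otimes>\<^sub>o\<^bsub>K\<^esub> Z) (X \<otimes>\<^sub>o\<^bsub>K\<^esub> (Y \<otimes>\<^sub>o\<^bsub>K\<^esub> Z))"
      if "X \<in> Obj K" "Y \<in> Obj K" "Z \<in> Obj K" for X Y Z
      using that by (simp add: hom_iff)
    show "iso K (Assoc K X Y Z)" if "X \<in> Obj K" "Y \<in> Obj K" "Z \<in> Obj K" for X Y Z
      using that by (simp add: J_iso)
    show "Assoc K X' Y' Z' \<cdot>\<^bsub>K\<^esub> ((F \<otimes>\<^bsub>K\<^esub> G) \<otimes>\<^bsub>K\<^esub> H) = (F \<otimes>\<^bsub>K\<^esub> (G \<otimes>\<^bsub>K\<^esub> H)) \<cdot>\<^bsub>K\<^esub> Assoc K X Y Z"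
      if "F \<in> hom K X X'" "G \<in> hom K Y Y'" "H \<in> hom K Z Z'" for F G H X X' Y Y' Z Z'
      using that by (elim kleisli_homE) (simp add: J_postcomp J_precomp kleisli_assoc_natural)
    show "Lunit K X \<in> hom K (Unit K \<otimes>\<^sub>o\<^bsub>K\<^esub> X) X" if "X \<in> Obj K" for X
      using that by (simp add: hom_iff)
    show "iso K (Lunit K X)" if "X \<in> Obj K" for X
      using that by (simp add: J_iso)
    show "Lunit K Y \<cdot>\<^bsub>K\<^esub> (Ident K (Unit K) \<otimes>\<^bsub>K\<^esub> F) = F \<cdot>\<^bsub>K\<^esub> Lunit K X" if "F \<in> hom K X Y" for F X Y
      using that by (elim kleisli_homE) (simp add: J_postcomp J_precomp kleisli_lunit_natural)
    show "Runit K X \<in> hom K (X \<otimes>\<^sub>o\<^bsub>K\<^esub> Unit K) X" if "X \<in> Obj K" for X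
      using that by (simp add: hom_iff)
    show "iso K (Runit K X)" if "X \<in> Obj K" for X
      using that by (simp add: J_iso)
    show "Runit K Y \<cdot>\<^bsub>K\<^esub> (F \<otimes>\<^bsub>K\<^esub> Ident K (Unit K)) = F \<cdot>\<^bsub>K\<^esub> Runit K X" if "F \<in> hom K X Y" for F X Y
      using that by (elim kleisli_homE) (simp add: J_postcomp J_precomp kleisli_runit_natural)
    show "Braid K X Y \<in> hom K (X \<otimes>\<^sub>o\<^bsub>K\<^esub> Y) (Y \<otimes>\<^sub>o\<^bsub>K\<^esub> X)" if "X \<in> Obj K" "Y \<in> Obj K" for X Y
      using that by (simp add: hom_iff)
    show "Braid K X' Y' \<cdot>\<^bsub>K\<^esub> (F \<otimes>\<^bsub>K\<^esub> G) = (G \<otimes>\<^bsub>K\<^esub> F) \<cdot>\<^bsub>K\<^esub> Braid K X Y"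
      if "F \<in> hom K X X'" "G \<in> hom K Y Y'" for F G X X' Y Y'
      using that by (elim kleisli_homE) (simp add: J_postcomp J_precomp kleisli_braid_natural)
    show "Braid K Y X \<cdot>\<^bsub>K\<^esub> Braid K X Y = Ident K (X \<otimes>\<^sub>o\<^bsub>K\<^esub> Y)" if "X \<in> Obj K" "Y \<in> Obj K" for X Y
      using that by (simp add: J_simps braid_symmetric)
    show "Assoc K W X (Y \<otimes>\<^sub>o\<^bsub>K\<^esub> Z) \<cdot>\<^bsub>K\<^esub> Assoc K (W \<otimes>\<^sub>o\<^bsub>K\<^esub> X) Y Z =
        (Ident K W \<otimes>\<^bsub>K\<^esub> Assoc K X Y Z) \<cdot>\<^bsub>K\<^esub> Assoc K W (X \<otimes>\<^sub>o\<^bsub>K\<^esub> Y) Z \<cdot>\<^bsub>K\<^esub>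
          (Assoc K W X Y \<otimes>\<^bsub>K\<^esub> Ident K Z)"
      if "W \<in> Obj K" "X \<in> Obj K" "Y \<in> Obj K" "Z \<in> Obj K" for W X Y Z
      using that by (simp add: J_simps pentagon)
    show "(Ident K X \<otimes>\<^bsub>K\<^esub> Lunit K Y) \<cdot>\<^bsub>K\<^esub> Assoc K X (Unit K) Y = Runit K X \<otimes>\<^bsub>K\<^esub> Ident K Y"
      if "X \<in> Obj K" "Y \<in> Obj K" for X Y
      using that by (simp add: J_simps triangle)
    show "Assoc K Y Z X \<cdot>\<^bsub>K\<^esub> Braid K X (Y \<otimes>\<^sub>o\<^bsub>K\<^esub> Z) \<cdot>\<^bsub>K\<^esub> Assoc K X Y Z =
        (Ident K Y \<otimes>\<^bsub>K\<^esub> Braid K X Z) \<cdot>\<^bsub>K\<^esub> Assoc K Y X Z \<cdot>\<^bsub>K\<^esub> (Braid K X Y \<otimes>\<^bsub>K\<^esub> Ident K Z)"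
      if "X \<in> Obj K" "Y \<in> Obj K" "Z \<in> Obj K" for X Y Z
      using that by (simp add: J_simps hexagon)
  qed
qed

section \<open>Duplication, deletion and the order\<close>

lemma kleisli_dup_del:
  assumes "gs_monoidal_category C" "X \<in> Obj C"
  shows "Dup K X = J (\<nabla> X)" "Del K X = J (Del C X)"
proof -
  interpret gs_monoidal_category C by fact
  show "Dup K X = J (\<nabla> X)" "Del K X = J (Del C X)"
    using assms by (simp_all add: Kleisli_def kleisli_embed_def)
qed

lemma kleisli_gs_monoidal:
  assumes "gs_monoidal_category C"
  shows "gs_monoidal_category K"
proof -
  interpret gs_monoidal_category C by fact
  interpret K: symmetric_monoidal_category K by (rule kleisli_symmetric_monoidal)
  note [simp] = kleisli_dup_del[OF assms]
  show ?thesis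
  proof
    show "Dup K X \<in> hom K X (X \<otimes>\<^sub>o\<^bsub>K\<^esub> X)" if "X \<in> Obj K" for X
      using that by (simp add: hom_iff)
    show "Del K X \<in> hom K X (Unit K)" if "X \<in> Obj K" for X
      using that by (simp add: hom_iff)
    show "Assoc K X X X \<cdot>\<^bsub>K\<^esub> (Dup K X \<otimes>\<^bsub>K\<^esub> Ident K X) \<cdot>\<^bsub>K\<^esub> Dup K X =
        (Ident K X \<otimes>\<^bsub>K\<^esub> Dup K X) \<cdot>\<^bsub>K\<^esub> Dup K X" if "X \<in> Obj K" for X
      using that by (simp add: J_simps dup_coassoc)
    show "Lunit K X \<cdot>\<^bsub>K\<^esub> (Del K X \<otimes>\<^bsub>K\<^esub> Ident K X) \<cdot>\<^bsub>K\<^esub> Dup K X = Ident K X" if "X \<in> Obj K" for X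
      using that by (simp add: J_simps dup_counit_left)
    show "Runit K X \<cdot>\<^bsub>K\<^esub> (Ident K X \<otimes>\<^bsub>K\<^esub> Del K X) \<cdot>\<^bsub>K\<^esub> Dup K X = Ident K X" if "X \<in> Obj K" for X
      using that by (simp add: J_simps dup_counit_right)
    show "Braid K X X \<cdot>\<^bsub>K\<^esub> Dup K X = Dup K X" if "X \<in> Obj K" for X
      using that by (simp add: J_simps dup_commutative)
    show "Dup K (X \<otimes>\<^sub>o\<^bsub>K\<^esub> Y) = middle_swap K X Y \<cdot>\<^bsub>K\<^esub> (Dup K X \<otimes>\<^bsub>K\<^esub> Dup K Y)"
      if "X \<in> Obj K" "Y \<in> Obj K" for X Y
    proof -
      have "middle_swap C X Y \<in> hom C ((X \<otimes>\<^sub>o X) \<otimes>\<^sub>o (Y \<otimes>\<^sub>o Y)) ((X \<otimes>\<^sub>o Y) \<otimes>\<^sub>o (X \<otimes>\<^sub>o Y))"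
        using that by (simp add: middle_swap_def hom_iff)
      then show ?thesis
        using that by (simp add: J_simps J_middle_swap dup_tensor hom_iff)
    qed
    show "Dup K (Unit K) = inv_arrow K (Lunit K (Unit K))"
      by (simp add: J_simps dup_unit)
    show "Del K (X \<otimes>\<^sub>o\<^bsub>K\<^esub> Y) = Lunit K (Unit K) \<cdot>\<^bsub>K\<^esub> (Del K X \<otimes>\<^bsub>K\<^esub> Del K Y)"
      if "X \<in> Obj K" "Y \<in> Obj K" for X Y
      using that by (simp add: J_simps del_tensor)
    show "Del K (Unit K) = Ident K (Unit K)"
      by (simp add: J_simps del_unit)
  qed
qed

lemma kleisli_preorder_enriched:
  assumes "colax_gs_monoidal_monad C T\<^sub>o T\<^sub>a \<mu> \<eta> c u"
  shows "preorder_enriched_gs_monoidal_category K"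
proof -
  interpret colax_gs_monoidal_monad C T\<^sub>o T\<^sub>a \<mu> \<eta> c u by fact
  interpret K: gs_monoidal_category K by (rule kleisli_gs_monoidal) unfold_locales
  show ?thesis
  proof
    show "reflp_on (hom K X Y) (Leq K)" for X Y
    proof (rule reflp_onI)
      fix F assume "F \<in> hom K X Y"
      then show "Leq K F F"
        by (elim kleisli_homE) simp
    qed
    show "transp_on (hom K X Y) (Leq K)" for X Y
    proof (rule transp_onI)
      fix F G H
      assume arrows: "F \<in> hom K X Y" "G \<in> hom K X Y" "H \<in> hom K X Y" and leq: "Leq K F G" "Leq K G H"
      obtain f where [simp]: "F = (X, f, Y)" and f: "f \<in> hom C X (T\<^sub>o Y)"
        using arrows(1) by (rule kleisli_homE) (simp add: hom_iff)
      obtain g where [simp]: "G = (X, g, Y)" and g: "g \<in> hom C X (T\<^sub>o Y)"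
        using arrows(2) by (rule kleisli_homE) (simp add: hom_iff)
      obtain h where [simp]: "H = (X, h, Y)" and h: "h \<in> hom C X (T\<^sub>o Y)"
        using arrows(3) by (rule kleisli_homE) (simp add: hom_iff)
      show "Leq K F H"
        using leq leq_trans[OF _ _ f g h] by simp
    qed
    show "Leq K (G \<cdot>\<^bsub>K\<^esub> F) (G' \<cdot>\<^bsub>K\<^esub> F')"
      if arrows: "F \<in> hom K X Y" "F' \<in> hom K X Y" "G \<in> hom K Y Z" "G' \<in> hom K Y Z"
        and leq: "Leq K F F'" "Leq K G G'" for F F' G G' X Y Z
    proof -
      obtain f where [simp]: "F = (X, f, Y)" "X \<in> Obj C" "Y \<in> Obj C" "f \<in> Arr C"
        "Dom C f = X" "Cod C f = T\<^sub>o Y"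
        using arrows(1) by (rule kleisli_homE)
      obtain f' where [simp]: "F' = (X, f', Y)" "f' \<in> Arr C" "Dom C f' = X" "Cod C f' = T\<^sub>o Y"
        using arrows(2) by (rule kleisli_homE)
      obtain g where [simp]: "G = (Y, g, Z)" "Z \<in> Obj C" "g \<in> Arr C" "Dom C g = Y" "Cod C g = T\<^sub>o Z"
        using arrows(3) by (rule kleisli_homE)
      obtain g' where [simp]: "G' = (Y, g', Z)" "g' \<in> Arr C" "Dom C g' = Y" "Cod C g' = T\<^sub>o Z"
        using arrows(4) by (rule kleisli_homE)
      have le: "f \<preceq> f'" "g \<preceq> g'"
        using leq by simp_all
      have "T\<^sub>a g \<preceq> T\<^sub>a g'"
        by (rule functor_mono[of _ Y "T\<^sub>o Z"]) (simp_all add: hom_iff le)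
      then have "\<mu> Z \<cdot> T\<^sub>a g \<cdot> f \<preceq> \<mu> Z \<cdot> T\<^sub>a g' \<cdot> f'"
        by (intro comp_mono_arr) (simp_all add: le)
      then show ?thesis
        by simp
    qed
    show "Leq K (F \<otimes>\<^bsub>K\<^esub> G) (F' \<otimes>\<^bsub>K\<^esub> G')"
      if arrows: "F \<in> hom K X X'" "F' \<in> hom K X X'" "G \<in> hom K Y Y'" "G' \<in> hom K Y Y'"
        and leq: "Leq K F F'" "Leq K G G'" for F F' G G' X X' Y Y'
    proof -
      obtain f where [simp]: "F = (X, f, X')" "X \<in> Obj C" "X' \<in> Obj C" "f \<in> Arr C"
        "Dom C f = X" "Cod C f = T\<^sub>o X'"
        using arrows(1) by (rule kleisli_homE)
      obtain f' where [simp]: "F' = (X, f', X')" "f' \<in> Arr C" "Dom C f' = X" "Cod C f' = T\<^sub>o X'"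
        using arrows(2) by (rule kleisli_homE)
      obtain g where [simp]: "G = (Y, g, Y')" "Y \<in> Obj C" "Y' \<in> Obj C" "g \<in> Arr C"
        "Dom C g = Y" "Cod C g = T\<^sub>o Y'"
        using arrows(3) by (rule kleisli_homE)
      obtain g' where [simp]: "G' = (Y, g', Y')" "g' \<in> Arr C" "Dom C g' = Y" "Cod C g' = T\<^sub>o Y'"
        using arrows(4) by (rule kleisli_homE)
      have le: "f \<preceq> f'" "g \<preceq> g'"
        using leq by simp_all
      have "c X' Y' \<cdot> (f \<otimes> g) \<preceq> c X' Y' \<cdot> (f' \<otimes> g')"
        by (intro comp_mono_arr tensor_mono_arr) (simp_all add: le)
      then show ?thesis
        by simp
    qed
  qed
qed

text \<open>
  The colax law of \<open>T\<close> is whiskered with \<open>f\<close> on the right, the oplax law of \<open>C\<close> for \<open>f\<close> with \<open>c\<close>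
  or \<open>\<eta>\<close> on the left; the two inequalities meet in \<open>c Y Y \<cdot> \<nabla> (T Y) \<cdot> f\<close> and in \<open>\<eta> \<I> \<cdot> ! (T Y) \<cdot> f\<close>.
\<close>

lemma kleisli_oplax_cartesian:
  assumes "colax_gs_monoidal_monad C T\<^sub>o T\<^sub>a \<mu> \<eta> c u"
    and "oplax_cartesian_category C"
  shows "oplax_cartesian_category K"
proof -
  interpret colax_gs_monoidal_monad C T\<^sub>o T\<^sub>a \<mu> \<eta> c u by fact
  interpret oplax_cartesian_category C by fact
  interpret K: preorder_enriched_gs_monoidal_category K
    by (rule kleisli_preorder_enriched) fact
  note [simp] = kleisli_dup_del[OF gs_monoidal_category_axioms]
  show ?thesis
  proof
    show "Leq K (Dup K Y \<cdot>\<^bsub>K\<^esub> F) ((F \<otimes>\<^bsub>K\<^esub> F) \<cdot>\<^bsub>K\<^esub> Dup K X)" if F: "F \<in> hom K X Y" for F X Y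
    proof -
      obtain f where [simp]: "F = (X, f, Y)" "X \<in> Obj C" "Y \<in> Obj C" "f \<in> Arr C"
        "Dom C f = X" "Cod C f = T\<^sub>o Y"
        using F by (rule kleisli_homE)
      have "T\<^sub>a (\<nabla> Y) \<cdot> f \<preceq> (c Y Y \<cdot> \<nabla> (T\<^sub>o Y)) \<cdot> f"
        by (rule comp_mono_arr) (simp_all add: colax_relevant)
      moreover have "c Y Y \<cdot> (\<nabla> (T\<^sub>o Y) \<cdot> f) \<preceq> c Y Y \<cdot> ((f \<otimes> f) \<cdot> \<nabla> X)"
        by (rule comp_mono_arr) (use dup_oplax[of f X "T\<^sub>o Y"] in \<open>simp_all add: hom_iff\<close>)
      ultimately have "T\<^sub>a (\<nabla> Y) \<cdot> f \<preceq> c Y Y \<cdot> (f \<otimes> f) \<cdot> \<nabla> X"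
        using leq_trans[of "T\<^sub>a (\<nabla> Y) \<cdot> f" "c Y Y \<cdot> \<nabla> (T\<^sub>o Y) \<cdot> f" _ X "T\<^sub>o (Y \<otimes>\<^sub>o Y)"]
        by (simp add: hom_iff)
      then show ?thesis
        by (simp add: J_postcomp J_precomp)
    qed
    show "Leq K (Del K Y \<cdot>\<^bsub>K\<^esub> F) (Del K X)" if F: "F \<in> hom K X Y" for F X Y
    proof -
      obtain f where [simp]: "F = (X, f, Y)" "X \<in> Obj C" "Y \<in> Obj C" "f \<in> Arr C"
        "Dom C f = X" "Cod C f = T\<^sub>o Y"
        using F by (rule kleisli_homE)
      have "T\<^sub>a (Del C Y) \<cdot> f \<preceq> (\<eta> \<I> \<cdot> Del C (T\<^sub>o Y)) \<cdot> f"
        using colax_affine[of Y] by (intro comp_mono_arr) (simp_all add: unit_eq_eta)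
      moreover have "\<eta> \<I> \<cdot> (Del C (T\<^sub>o Y) \<cdot> f) \<preceq> \<eta> \<I> \<cdot> Del C X"
        by (rule comp_mono_arr) (use del_oplax[of f X "T\<^sub>o Y"] in \<open>simp_all add: hom_iff\<close>)
      ultimately have "T\<^sub>a (Del C Y) \<cdot> f \<preceq> \<eta> \<I> \<cdot> Del C X"
        using leq_trans[of "T\<^sub>a (Del C Y) \<cdot> f" "\<eta> \<I> \<cdot> Del C (T\<^sub>o Y) \<cdot> f" _ X "T\<^sub>o \<I>"]
        by (simp add: hom_iff)
      then show ?thesis
        by (simp add: J_postcomp) (simp add: kleisli_embed_def)
    qed
  qed
qed

end

theorem proposition4p16:
  fixes C :: "('o, 'a) pgs_data"
    and T\<^sub>o :: "'o \<Rightarrow> 'o" and T\<^sub>a :: "'a \<Rightarrow> 'a"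
    and \<mu> :: "'o \<Rightarrow> 'a" and \<eta> :: "'o \<Rightarrow> 'a"
    and c :: "'o \<Rightarrow> 'o \<Rightarrow> 'a" and u :: 'a
  assumes "colax_gs_monoidal_monad C T\<^sub>o T\<^sub>a \<mu> \<eta> c u"
    and "oplax_cartesian_category C"
  shows "oplax_cartesian_category (Kleisli C T\<^sub>o T\<^sub>a \<mu> \<eta> c)"
proof -
  interpret colax_gs_monoidal_monad C T\<^sub>o T\<^sub>a \<mu> \<eta> c u by fact
  interpret kleisli_construction C T\<^sub>o T\<^sub>a \<mu> \<eta> c u by unfold_locales
  show ?thesis
    using assms by (rule kleisli_oplax_cartesian)
qed

end
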